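(* Let $X$ be a non-negative, absolutely continuous, DMRD random variable with $\mathbb{E}X<+\infty$, and let $\phi:\mathbb{R}_+\to\mathbb{R}_+$ be a strictly increasing, concave and differentiable function. Then $Y:=\phi(X)$ is DMRD.
   Context: For a non-negative random variable $Z$ with continuous distribution function $F_Z$, tail $\bar F_Z:=1-F_Z$ and finite expectation, let $H_Z:=\inf\{p\ge 0: F_Z(p)=1\}\le+\infty$. The mean residual demand (MRD) function of $Z$ is $\mathrm{m}_Z(p):=\mathbb{E}(Z-p\mid Z>p)=\frac{1}{\bar F_Z(p)}\int_p^{+\infty}\bar F_Z(u)\,du$ for $p<H_Z$ and $\mathrm{m}_Z(p):=0$ otherwise. $Z$ is DMRD (decreasing mean residual demand) if $\mathrm{m}_Z(p)$ is non-increasing in $p$ for $p<H_Z$. *)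

theory Defs
  imports "HOL-Probability.Probability"
begin

definition dist_fun :: "'a measure \<Rightarrow> ('a \<Rightarrow> real) \<Rightarrow> real \<Rightarrow> real" where
  "dist_fun M Z = cdf (distr M borel Z)"

definition tail_fun :: "'a measure \<Rightarrow> ('a \<Rightarrow> real) \<Rightarrow> real \<Rightarrow> real" where
  "tail_fun M Z p = 1 - dist_fun M Z p"

text \<open>The value is \<open>\<infinity>\<close> (the infimum of the empty set) if the distribution function never reaches 1.\<close>

definition upper_end :: "'a measure \<Rightarrow> ('a \<Rightarrow> real) \<Rightarrow> ereal" where
  "upper_end M Z = Inf (ereal ` {p. 0 \<le> p \<and> dist_fun M Z p = 1})"

definition mrd :: "'a measure \<Rightarrow> ('a \<Rightarrow> real) \<Rightarrow> real \<Rightarrow> real" where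
  "mrd M Z p = (if ereal p < upper_end M Z
      then 1 / tail_fun M Z p * (LINT u:{p<..}|lborel. tail_fun M Z u) else 0)"

text \<open>Conditional expectation given an event is integration against \<^const>\<open>uniform_measure\<close>.
  The following lemma shows that \<^const>\<open>mrd\<close> is \<open>E(Z - p | Z > p)\<close>.\<close>

lemma (in prob_space) mrd_eq_conditional_expectation:
  fixes Z :: "'a \<Rightarrow> real"
  assumes Z: "random_variable borel Z" and int: "integrable M Z"
    and nonneg: "\<And>\<omega>. \<omega> \<in> space M \<Longrightarrow> 0 \<le> Z \<omega>" and p: "ereal p < upper_end M Z"
  shows "mrd M Z p = (LINT \<omega>|uniform_measure M {\<omega> \<in> space M. p < Z \<omega>}. Z \<omega> - p)"
proof -
  note [measurable] = Z
  let ?A = "\<lambda>u. {\<omega> \<in> space M. u < Z \<omega>}"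
  interpret D: prob_space "distr M borel Z" by (rule prob_space_distr) simp
  interpret PP: pair_sigma_finite M lborel by unfold_locales
  have tail: "tail_fun M Z u = prob (?A u)" for u
  proof -
    have eq: "Z -` {..u} \<inter> space M = space M - ?A u" by auto
    have "dist_fun M Z u = prob (space M - ?A u)"
      by (simp add: dist_fun_def cdf_def measure_distr eq)
    also have "\<dots> = 1 - prob (?A u)" by (rule prob_compl) simp
    finally show ?thesis by (simp add: tail_fun_def)
  qed
  have [measurable]: "?A p \<in> sets M" by simp
  have "(\<integral>\<^sup>+ u. ennreal (indicator {p<..} u * prob (?A u)) \<partial>lborel)
      = (\<integral>\<^sup>+ u. \<integral>\<^sup>+ \<omega>. indicator {p<..} u * indicator {\<omega>. u < Z \<omega>} \<omega> \<partial>M \<partial>lborel)"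
  proof (rule nn_integral_cong)
    fix u :: real
    have "(\<integral>\<^sup>+ \<omega>. indicator {p<..} u * indicator {\<omega>. u < Z \<omega>} \<omega> \<partial>M)
        = (\<integral>\<^sup>+ \<omega>. indicator {p<..} u * indicator (?A u) \<omega> \<partial>M)"
      by (intro nn_integral_cong) (auto split: split_indicator)
    also have "\<dots> = indicator {p<..} u * emeasure M (?A u)"
      by (simp add: nn_integral_cmult)
    also have "\<dots> = ennreal (indicator {p<..} u * prob (?A u))"
      by (simp add: emeasure_eq_measure ennreal_mult ennreal_indicator)
    finally show "ennreal (indicator {p<..} u * prob (?A u)) =
      (\<integral>\<^sup>+ \<omega>. indicator {p<..} u * indicator {\<omega>. u < Z \<omega>} \<omega> \<partial>M)" by simp
  qed
  also have "\<dots> = (\<integral>\<^sup>+ \<omega>. \<integral>\<^sup>+ u. indicator {p<..} u * indicator {\<omega>. u < Z \<omega>} \<omega> \<partial>lborel \<partial>M)"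
    by (rule PP.Fubini') simp
  also have "\<dots> = (\<integral>\<^sup>+ \<omega>. ennreal (indicator (?A p) \<omega> * (Z \<omega> - p)) \<partial>M)"
  proof (rule nn_integral_cong)
    fix \<omega> assume w: "\<omega> \<in> space M"
    have "(\<integral>\<^sup>+ u. indicator {p<..} u * indicator {\<omega>. u < Z \<omega>} \<omega> \<partial>lborel)
        = (\<integral>\<^sup>+ u. indicator {p<..<Z \<omega>} u \<partial>lborel)"
      by (intro nn_integral_cong) (auto split: split_indicator)
    also have "\<dots> = emeasure lborel {p<..<Z \<omega>}" by simp
    also have "\<dots> = ennreal (indicator (?A p) \<omega> * (Z \<omega> - p))"
      using w by (cases "p < Z \<omega>") auto
    finally show "(\<integral>\<^sup>+ u. indicator {p<..} u * indicator {\<omega>. u < Z \<omega>} \<omega> \<partial>lborel)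
        = ennreal (indicator (?A p) \<omega> * (Z \<omega> - p))" .
  qed
  finally have nn: "(\<integral>\<^sup>+ u. ennreal (indicator {p<..} u * prob (?A u)) \<partial>lborel)
      = (\<integral>\<^sup>+ \<omega>. ennreal (indicator (?A p) \<omega> * (Z \<omega> - p)) \<partial>M)" .
  have "(LINT u|lborel. indicator {p<..} u * prob (?A u))
      = (LINT \<omega>|M. indicator (?A p) \<omega> * (Z \<omega> - p))"
    by (subst (1 2) integral_eq_nn_integral) (auto simp: nn split: split_indicator)
  then have fub: "(LINT u:{p<..}|lborel. tail_fun M Z u)
      = (LINT \<omega>|M. indicator (?A p) \<omega> * (Z \<omega> - p))"
    by (simp add: set_lebesgue_integral_def tail)
  have pos: "0 < prob (?A p)"
  proof (rule ccontr)
    assume "\<not> 0 < prob (?A p)"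
    then have 0: "prob (?A p) = 0" by (simp add: zero_less_measure_iff)
    have "0 \<le> p"
    proof (rule ccontr)
      assume "\<not> 0 \<le> p"
      then have "?A p = space M" using nonneg by force
      then show False using 0 prob_space by simp
    qed
    moreover have "dist_fun M Z p = 1" using 0 tail[of p] by (simp add: tail_fun_def)
    ultimately have "upper_end M Z \<le> ereal p"
      unfolding upper_end_def by (intro Inf_lower) auto
    then show False using p by simp
  qed
  have um: "uniform_measure M (?A p) = density M (\<lambda>\<omega>. ennreal (indicator (?A p) \<omega> / prob (?A p)))"
    unfolding uniform_measure_def using pos divide_ennreal[of 1 "prob (?A p)"]
    by (intro arg_cong[where f = "density M"] ext)
      (auto simp: emeasure_eq_measure split: split_indicator)
  have "(LINT \<omega>|uniform_measure M (?A p). Z \<omega> - p)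
      = (LINT \<omega>|M. (indicator (?A p) \<omega> / prob (?A p)) * (Z \<omega> - p))"
    unfolding um by (subst integral_density) auto
  also have "\<dots> = (LINT \<omega>|M. indicator (?A p) \<omega> * (Z \<omega> - p)) / prob (?A p)"
    by (subst integral_divide_zero[symmetric]) (rule Bochner_Integration.integral_cong; simp)
  finally show ?thesis
    using p by (simp add: mrd_def fub tail)
qed

text \<open>Besides monotonicity of \<^const>\<open>mrd\<close>, the predicate contains the standing requirements on \<open>Z\<close>
  under which the mean residual demand is defined.\<close>

definition DMRD :: "'a measure \<Rightarrow> ('a \<Rightarrow> real) \<Rightarrow> bool" where
  "DMRD M Z \<longleftrightarrow>
     Z \<in> borel_measurable M \<and> (\<forall>\<omega>\<in>space M. 0 \<le> Z \<omega>) \<and>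
     continuous_on UNIV (dist_fun M Z) \<and> integrable M Z \<and>
     antimono_on {p. ereal p < upper_end M Z} (mrd M Z)"

end

theory Submission
  imports Defs
begin

text \<open>
  Write \<open>Y = \<phi> \<circ> X\<close>. Since \<open>\<phi>\<close> is increasing, the level \<open>p = \<phi> q\<close> gives
  \<open>m\<^sub>Y p = A q / P (X > q)\<close> with \<open>A q = E (\<phi> X - \<phi> q)\<^sup>+\<close>, while \<open>m\<^sub>X q = B q / P (X > q)\<close> with
  \<open>B q = E (X - q)\<^sup>+\<close>. Take \<open>0 \<le> a \<le> b\<close> and let \<open>c \<ge> 0\<close> be the slope of a supporting line of the
  concave function \<open>\<phi>\<close> at \<open>b\<close>: \<open>\<phi>\<close> has slope at least \<open>c\<close> on \<open>[a, b]\<close> and lies below the line to the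
  right of \<open>b\<close>. Hence \<open>A b \<le> c * B b\<close> and \<open>A a - A b \<ge> c * (B a - B b)\<close>
  (\<open>excess_comparison\<close>). These two bounds, with \<open>P (X > b) \<le> P (X > a)\<close>, turn
  \<open>B b / P (X > b) \<le> B a / P (X > a)\<close>, which is the DMRD property of \<open>X\<close>, into the same
  inequality for \<open>A\<close> (\<open>ratio_transfer\<close>). Levels \<open>p < \<phi> 0\<close> reduce to
  \<open>p = \<phi> 0\<close>, because \<open>P (Y > p) = 1 = P (X > 0)\<close> there.
\<close>

section \<open>Mean residual demand as a ratio\<close>

lemma (in prob_space) tail_fun_eq_prob:
  assumes [measurable]: "random_variable borel Z"
  shows "tail_fun M Z p = prob {\<omega> \<in> space M. p < Z \<omega>}"
proof -
  have eq: "Z -` {..p} \<inter> space M = space M - {\<omega> \<in> space M. p < Z \<omega>}" by auto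
  show ?thesis
    by (simp add: tail_fun_def dist_fun_def cdf_def measure_distr eq prob_compl)
qed

lemma (in prob_space) prob_exceed_pos:
  fixes Z :: "'a \<Rightarrow> real"
  assumes Z: "random_variable borel Z"
    and nonneg: "\<And>\<omega>. \<omega> \<in> space M \<Longrightarrow> 0 \<le> Z \<omega>" and p: "ereal p < upper_end M Z"
  shows "0 < prob {\<omega> \<in> space M. p < Z \<omega>}"
proof (cases "0 \<le> p")
  case True
  show ?thesis
  proof (rule ccontr)
    assume "\<not> 0 < prob {\<omega> \<in> space M. p < Z \<omega>}"
    then have "prob {\<omega> \<in> space M. p < Z \<omega>} = 0" by (simp add: zero_less_measure_iff)
    then have "dist_fun M Z p = 1" using tail_fun_eq_prob[OF Z, of p] by (simp add: tail_fun_def)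
    then have "upper_end M Z \<le> ereal p"
      unfolding upper_end_def using True by (intro Inf_lower) auto
    then show False using p by simp
  qed
next
  case False
  then have "{\<omega> \<in> space M. p < Z \<omega>} = space M" using nonneg by force
  then show ?thesis by (simp add: prob_space)
qed

lemma (in prob_space) mrd_eq_ratio:
  fixes Z :: "'a \<Rightarrow> real"
  assumes Z[measurable]: "random_variable borel Z" and "integrable M Z"
    and nonneg: "\<And>\<omega>. \<omega> \<in> space M \<Longrightarrow> 0 \<le> Z \<omega>" and p: "ereal p < upper_end M Z"
  shows "mrd M Z p = expectation (\<lambda>\<omega>. max 0 (Z \<omega> - p)) / prob {\<omega> \<in> space M. p < Z \<omega>}"
proof -
  let ?A = "{\<omega> \<in> space M. p < Z \<omega>}"
  have pos: "0 < prob ?A" using Z nonneg p by (rule prob_exceed_pos)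
  have "uniform_measure M ?A = density M (\<lambda>\<omega>. ennreal (indicator ?A \<omega> / prob ?A))"
    unfolding uniform_measure_def using pos divide_ennreal[of 1 "prob ?A"]
    by (intro arg_cong[where f = "density M"] ext)
      (auto simp: emeasure_eq_measure split: split_indicator)
  then have "(LINT \<omega>|uniform_measure M ?A. Z \<omega> - p)
      = expectation (\<lambda>\<omega>. indicator ?A \<omega> / prob ?A * (Z \<omega> - p))"
    by (simp add: integral_density)
  also have "\<dots> = expectation (\<lambda>\<omega>. max 0 (Z \<omega> - p) / prob ?A)"
    by (rule Bochner_Integration.integral_cong) (auto split: split_indicator)
  finally show ?thesis
    using mrd_eq_conditional_expectation[OF assms] by simp
qed

text \<open>Converse of \<open>prob_exceed_pos\<close>. Continuity of the distribution function makes the set where the tail is positive open,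
  so that a positive tail at \<open>p\<close> puts \<open>p\<close> strictly below the infimum.\<close>

lemma (in prob_space) less_upper_end:
  fixes Z :: "'a \<Rightarrow> real"
  assumes Z[measurable]: "random_variable borel Z" and cont: "continuous_on UNIV (dist_fun M Z)"
    and pos: "0 < prob {\<omega> \<in> space M. p < Z \<omega>}"
  shows "ereal p < upper_end M Z"
proof -
  have tail: "dist_fun M Z r = 1 - prob {\<omega> \<in> space M. r < Z \<omega>}" for r
    using tail_fun_eq_prob[OF Z, of r] by (simp add: tail_fun_def)
  have "open (dist_fun M Z -` {..<1})"
    using cont by (intro open_vimage) (auto simp: continuous_on_eq_continuous_at)
  moreover have "p \<in> dist_fun M Z -` {..<1}" using pos tail[of p] by simp
  ultimately obtain e where e: "e > 0" "cball p e \<subseteq> dist_fun M Z -` {..<1}"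
    by (meson open_contains_cball)
  moreover have "p + e \<in> cball p e" using e(1) by (simp add: dist_real_def)
  ultimately have "p + e \<in> dist_fun M Z -` {..<1}" by blast
  then have *: "0 < prob {\<omega> \<in> space M. p + e < Z \<omega>}" using tail[of "p + e"] by simp
  have "p + e \<le> r" if "dist_fun M Z r = 1" for r
  proof (rule ccontr)
    assume "\<not> p + e \<le> r"
    then have "prob {\<omega> \<in> space M. p + e < Z \<omega>} \<le> prob {\<omega> \<in> space M. r < Z \<omega>}"
      by (intro finite_measure_mono) auto
    then show False using * that tail[of r] by simp
  qed
  then have "ereal (p + e) \<le> upper_end M Z"
    unfolding upper_end_def by (intro Inf_greatest) auto
  moreover have "ereal p < ereal (p + e)" using e by simp
  ultimately show ?thesis by (rule less_le_trans[rotated])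
qed

section \<open>Supporting lines of a concave function on the half-line\<close>

text \<open>The first bound says that \<open>c\<close> is the slope of a supporting line at \<open>b\<close>; the second, that all
  slopes of \<open>\<phi>\<close> to the left of \<open>b\<close> are at least \<open>c\<close>. The slope is the derivative of \<open>\<phi>\<close> at \<open>b\<close>,
  one-sided for \<open>b = 0\<close>, which is why it is found by restricting \<open>\<phi>\<close> to the segment from \<open>b\<close> to \<open>x\<close>.\<close>

lemma concave_support:
  fixes \<phi> :: "real \<Rightarrow> real"
  assumes conc: "concave_on {0..} \<phi>" and mono: "strict_mono_on {0..} \<phi>"
    and diff: "\<phi> differentiable_on {0..}" and b: "0 \<le> b"
  shows "\<exists>c\<ge>0. (\<forall>x\<ge>0. \<phi> x \<le> \<phi> b + c * (x - b)) \<and>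
    (\<forall>x y. 0 \<le> x \<longrightarrow> x \<le> y \<longrightarrow> y \<le> b \<longrightarrow> c * (y - x) \<le> \<phi> y - \<phi> x)"
proof -
  from diff b obtain c where c: "(\<phi> has_real_derivative c) (at b within {0..})"
    unfolding differentiable_on_def real_differentiable_def by auto
  have chord: "\<phi> u + t * (\<phi> v - \<phi> u) \<le> \<phi> (u + t * (v - u))"
    if "0 \<le> u" "0 \<le> v" "0 \<le> t" "t \<le> 1" for u v t
    using concave_onD[OF conc that(3,4), of u v] that by (simp add: algebra_simps)
  have above: "\<phi> x \<le> \<phi> b + c * (x - b)" if x: "0 \<le> x" for x
  proof -
    let ?g = "\<lambda>t. \<phi> (b + t * (x - b))"
    have "b + t * (x - b) \<in> {0..}" if "t \<in> {0..1}" for t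
    proof -
      have "b + t * (x - b) = (1 - t) * b + t * x" by (simp add: algebra_simps)
      then show ?thesis using that b x by simp
    qed
    then have "(\<lambda>t. b + t * (x - b)) ` {0..1} \<subseteq> {0..}" by blast
    then have "(\<phi> has_real_derivative c) (at (b + 0 * (x - b)) within (\<lambda>t. b + t * (x - b)) ` {0..1})"
      using c by (simp add: DERIV_subset)
    moreover have "((\<lambda>t. b + t * (x - b)) has_real_derivative (x - b)) (at 0 within {0..1})"
      by (auto intro!: derivative_eq_intros)
    ultimately have "(?g has_real_derivative c * (x - b)) (at 0 within {0..1})"
      using DERIV_image_chain[of \<phi> c "\<lambda>t. b + t * (x - b)" 0 "{0..1}" "x - b"] by (simp add: o_def)
    then have lim: "((\<lambda>t. (?g t - \<phi> b) / t) \<longlongrightarrow> c * (x - b)) (at 0 within {0..1})"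
      by (simp add: has_field_derivative_iff)
    \<comment> \<open>By concavity every difference quotient along the segment dominates the one at \<open>t = 1\<close>.\<close>
    have "\<forall>\<^sub>F t in at 0 within {0..1}. \<phi> x - \<phi> b \<le> (?g t - \<phi> b) / t"
      unfolding eventually_at_filter
    proof (rule always_eventually, intro allI impI)
      fix t :: real
      assume "t \<noteq> 0" "t \<in> {0..1}"
      then show "\<phi> x - \<phi> b \<le> (?g t - \<phi> b) / t"
        using chord[of b x t] b x by (simp add: field_simps)
    qed
    then have "\<phi> x - \<phi> b \<le> c * (x - b)"
      by (rule tendsto_lowerbound[OF lim]) (simp add: trivial_limit_within islimpt_Icc)
    then show ?thesis by simp
  qed
  have "0 \<le> c"
  proof -
    have "\<phi> b < \<phi> (b + 1)" using mono b by (simp add: strict_mono_on_def)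
    then show ?thesis using above[of "b + 1"] b by simp
  qed
  moreover have "c * (y - x) \<le> \<phi> y - \<phi> x" if xy: "0 \<le> x" "x \<le> y" "y \<le> b" for x y
  proof (cases "x = b")
    case True
    then show ?thesis using xy by simp
  next
    case False
    define s where "s = (y - x) / (b - x)"
    have s: "0 \<le> s" "s \<le> 1" "s * (b - x) = y - x" using False xy by (auto simp: s_def)
    \<comment> \<open>Concavity on \<open>[x, b]\<close> makes the slope from \<open>x\<close> to \<open>y\<close> at least the slope from \<open>x\<close> to \<open>b\<close>.\<close>
    have "c * (y - x) = s * (c * (b - x))" using s(3) by (metis mult.left_commute)
    also have "\<dots> \<le> s * (\<phi> b - \<phi> x)"
      using above[of x] xy s by (intro mult_left_mono) (auto simp: algebra_simps)
    also have "\<dots> \<le> \<phi> y - \<phi> x" using chord[of x b s] xy s by simp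
    finally show ?thesis .
  qed
  ultimately show ?thesis using above by blast
qed

section \<open>Transfer of the monotone ratio\<close>

lemma ratio_transfer:
  fixes A1 A2 B1 B2 P1 P2 c :: real
  assumes P: "0 < P2" "P2 \<le> P1" and A2: "A2 \<le> c * B2" and diff: "c * (B1 - B2) \<le> A1 - A2"
    and "0 \<le> c" and B: "B2 / P2 \<le> B1 / P1"
  shows "A2 / P2 \<le> A1 / P1"
proof -
  have "B2 * P1 \<le> B1 * P2" using B P by (simp add: field_simps)
  then have "c * (B2 * P1) \<le> c * (B1 * P2)" using \<open>0 \<le> c\<close> by (rule mult_left_mono)
  moreover have "A2 * (P1 - P2) \<le> c * B2 * (P1 - P2)" using A2 P by (intro mult_right_mono) auto
  moreover have "c * (B1 - B2) * P2 \<le> (A1 - A2) * P2" using diff P by (intro mult_right_mono) auto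
  ultimately have "A2 * P1 \<le> A1 * P2" by (simp add: algebra_simps)
  then show ?thesis using P by (simp add: field_simps)
qed

lemma (in prob_space) excess_comparison:
  fixes X :: "'a \<Rightarrow> real" and \<phi> :: "real \<Rightarrow> real"
  assumes intX: "integrable M X" and intY: "integrable M (\<lambda>\<omega>. \<phi> (X \<omega>))"
    and nonneg: "\<And>\<omega>. \<omega> \<in> space M \<Longrightarrow> 0 \<le> X \<omega>" and mono: "strict_mono_on {0..} \<phi>"
    and ab: "0 \<le> a" "a \<le> b" and "0 \<le> c"
    and above: "\<And>x. 0 \<le> x \<Longrightarrow> \<phi> x \<le> \<phi> b + c * (x - b)"
    and slope: "\<And>x y. 0 \<le> x \<Longrightarrow> x \<le> y \<Longrightarrow> y \<le> b \<Longrightarrow> c * (y - x) \<le> \<phi> y - \<phi> x"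
  defines "A \<equiv> \<lambda>q. expectation (\<lambda>\<omega>. max 0 (\<phi> (X \<omega>) - \<phi> q))"
    and "B \<equiv> \<lambda>q. expectation (\<lambda>\<omega>. max 0 (X \<omega> - q))"
  shows "A b \<le> c * B b" and "c * (B a - B b) \<le> A a - A b"
proof -
  have iX: "integrable M (\<lambda>\<omega>. max 0 (X \<omega> - q))" for q
    using intX by (intro integrable_max) auto
  have iY: "integrable M (\<lambda>\<omega>. max 0 (\<phi> (X \<omega>) - \<phi> q))" for q
    using intY by (intro integrable_max) auto
  have less: "\<phi> x \<le> \<phi> y \<longleftrightarrow> x \<le> y" if "0 \<le> x" "0 \<le> y" for x y
    using strict_mono_on_less_eq[OF mono, of x y] that by simp
  have "A b \<le> expectation (\<lambda>\<omega>. c * max 0 (X \<omega> - b))"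
    unfolding A_def
  proof (rule integral_mono[OF iY])
    show "integrable M (\<lambda>\<omega>. c * max 0 (X \<omega> - b))" using iX by simp
  next
    fix \<omega> assume "\<omega> \<in> space M"
    then show "max 0 (\<phi> (X \<omega>) - \<phi> b) \<le> c * max 0 (X \<omega> - b)"
      using above[of "X \<omega>"] nonneg[of \<omega>] less[of "X \<omega>" b] ab \<open>0 \<le> c\<close>
      by (cases "X \<omega> \<le> b") (auto simp: max_def)
  qed
  then show "A b \<le> c * B b" by (simp add: B_def)
  have "expectation (\<lambda>\<omega>. c * (max 0 (X \<omega> - a) - max 0 (X \<omega> - b)))
      \<le> expectation (\<lambda>\<omega>. max 0 (\<phi> (X \<omega>) - \<phi> a) - max 0 (\<phi> (X \<omega>) - \<phi> b))"
  proof (rule integral_mono)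
    show "integrable M (\<lambda>\<omega>. c * (max 0 (X \<omega> - a) - max 0 (X \<omega> - b)))"
      using iX by (intro integrable_mult_right Bochner_Integration.integrable_diff)
    show "integrable M (\<lambda>\<omega>. max 0 (\<phi> (X \<omega>) - \<phi> a) - max 0 (\<phi> (X \<omega>) - \<phi> b))"
      using iY by (intro Bochner_Integration.integrable_diff)
  next
    fix \<omega> assume "\<omega> \<in> space M"
    then have x: "0 \<le> X \<omega>" by (rule nonneg)
    consider "X \<omega> \<le> a" | "a \<le> X \<omega>" "X \<omega> \<le> b" | "b \<le> X \<omega>" by linarith
    then show "c * (max 0 (X \<omega> - a) - max 0 (X \<omega> - b))
        \<le> max 0 (\<phi> (X \<omega>) - \<phi> a) - max 0 (\<phi> (X \<omega>) - \<phi> b)"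
    proof cases
      case 1
      then show ?thesis using ab x less[of "X \<omega>" a] less[of "X \<omega>" b] by simp
    next
      case 2
      then show ?thesis
        using ab x less[of a "X \<omega>"] less[of "X \<omega>" b] slope[of a "X \<omega>"] by simp
    next
      case 3
      then show ?thesis
        using ab x less[of a "X \<omega>"] less[of b "X \<omega>"] slope[of a b] by simp
    qed
  qed
  then show "c * (B a - B b) \<le> A a - A b"
    using iX iY by (simp add: A_def B_def)
qed

section \<open>Increasing concave transformations of a DMRD variable\<close>

theorem theorem4p1:
  fixes M :: "'a measure" and X :: "'a \<Rightarrow> real" and \<phi> :: "real \<Rightarrow> real"
  assumes "prob_space M"
    and "X \<in> borel_measurable M"
    and "\<And>\<omega>. \<omega> \<in> space M \<Longrightarrow> 0 \<le> X \<omega>"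
    and "absolutely_continuous lborel (distr M borel X)"
    and "integrable M X"
    and "DMRD M X"
    and "\<phi> \<in> {0..} \<rightarrow> {0..}"
    and "strict_mono_on {0..} \<phi>"
    and "concave_on {0..} \<phi>"
    and "\<phi> differentiable_on {0..}"
  shows "DMRD M (\<phi> \<circ> X)"
proof -
  interpret prob_space M by fact
  note [measurable] = \<open>X \<in> borel_measurable M\<close>
  note nonneg = assms(3)
  have contX: "continuous_on UNIV (dist_fun M X)"
    and antiX: "antimono_on {p. ereal p < upper_end M X} (mrd M X)"
    using \<open>DMRD M X\<close> by (auto simp: DMRD_def)
  have le: "\<phi> x \<le> \<phi> y \<longleftrightarrow> x \<le> y" and less: "\<phi> x < \<phi> y \<longleftrightarrow> x < y" and eq: "\<phi> x = \<phi> y \<longleftrightarrow> x = y"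
    if "0 \<le> x" "0 \<le> y" for x y
    using strict_mono_on_less_eq[OF assms(8), of x y] strict_mono_on_less_eq[OF assms(8), of y x] that
    by auto
  define Y where "Y = (\<lambda>\<omega>. \<phi> (X \<omega>))"
  have Y_nonneg: "0 \<le> Y \<omega>" if "\<omega> \<in> space M" for \<omega>
    using assms(7) nonneg[OF that] by (auto simp: Y_def Pi_iff)
  \<comment> \<open>Replacing \<open>x\<close> by \<open>max 0 x\<close> gives a function that is monotone on the whole line.\<close>
  have "mono (\<lambda>x. \<phi> (max 0 x))" by (rule monoI) (simp add: le)
  then have "(\<lambda>x. \<phi> (max 0 x)) \<in> borel_measurable borel" by (rule borel_measurable_mono)
  then have "(\<lambda>\<omega>. \<phi> (max 0 (X \<omega>))) \<in> borel_measurable M" by (rule measurable_compose[rotated]) simp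
  then have Y[measurable]: "Y \<in> borel_measurable M"
    by (rule measurable_cong[THEN iffD1, rotated]) (simp add: Y_def nonneg)
  have intY: "integrable M Y"
  proof -
    obtain c where c: "0 \<le> c" "\<And>x. 0 \<le> x \<Longrightarrow> \<phi> x \<le> \<phi> 0 + c * (x - 0)"
      using concave_support[OF assms(9,8,10) order_refl] by blast
    show ?thesis
    proof (rule Bochner_Integration.integrable_bound)
      show "integrable M (\<lambda>\<omega>. \<phi> 0 + c * X \<omega>)" using assms(5) by simp
      show "AE \<omega> in M. norm (Y \<omega>) \<le> norm (\<phi> 0 + c * X \<omega>)"
      proof (rule AE_I2)
        fix \<omega> assume w: "\<omega> \<in> space M"
        show "norm (Y \<omega>) \<le> norm (\<phi> 0 + c * X \<omega>)"
          using c(2)[OF nonneg[OF w]] Y_nonneg[OF w] by (simp add: Y_def)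
      qed
    qed simp
  qed
  have no_atom: "prob {\<omega> \<in> space M. X \<omega> = x} = 0" for x
  proof -
    have "{x} \<in> null_sets lborel" by (simp add: null_sets_def)
    then have "{x} \<in> null_sets (distr M borel X)"
      using assms(4) unfolding absolutely_continuous_def by blast
    then have "emeasure M (X -` {x} \<inter> space M) = 0"
      by (auto simp: null_sets_def emeasure_distr)
    also have "X -` {x} \<inter> space M = {\<omega> \<in> space M. X \<omega> = x}" by auto
    finally show ?thesis by (simp add: measure_def)
  qed
  have contY: "continuous_on UNIV (dist_fun M Y)"
  proof -
    interpret D: real_distribution "distr M borel Y"
      by (rule real_distribution_distr) (rule Y)
    have "measure (distr M borel Y) {y} = 0" for y
    proof -
      have "measure (distr M borel Y) {y} = prob (Y -` {y} \<inter> space M)"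
        by (simp add: measure_distr)
      also have "\<dots> \<le> 0"
      proof (cases "\<exists>x\<ge>0. \<phi> x = y")
        case True
        then obtain x where x: "0 \<le> x" "\<phi> x = y" by auto
        have "Y -` {y} \<inter> space M \<subseteq> {\<omega> \<in> space M. X \<omega> = x}"
          using x eq nonneg by (auto simp: Y_def)
        then have "prob (Y -` {y} \<inter> space M) \<le> prob {\<omega> \<in> space M. X \<omega> = x}"
          by (intro finite_measure_mono) auto
        then show ?thesis by (simp add: no_atom)
      next
        case False
        then have "Y -` {y} \<inter> space M = {}" using nonneg by (auto simp: Y_def)
        then show ?thesis by simp
      qed
      finally show ?thesis by (simp add: measure_le_0_iff)
    qed
    then show ?thesis
      by (simp add: dist_fun_def continuous_on_eq_continuous_at D.isCont_cdf)
  qed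
  have levels: "{\<omega> \<in> space M. \<phi> q < Y \<omega>} = {\<omega> \<in> space M. q < X \<omega>}" if "0 \<le> q" for q
    using that nonneg by (auto simp: Y_def less)
  have surj: "\<exists>q\<ge>0. \<phi> q = p" if "\<phi> 0 \<le> p" "ereal p < upper_end M Y" for p
  proof -
    have "0 < prob {\<omega> \<in> space M. p < Y \<omega>}"
      using that(2) Y_nonneg by (intro prob_exceed_pos) auto
    then obtain \<omega> where w: "\<omega> \<in> space M" "p < Y \<omega>"
      by (metis (mono_tags, lifting) empty_Collect_eq less_irrefl measure_empty)
    have "continuous_on {0..X \<omega>} \<phi>"
      using differentiable_imp_continuous_on[OF assms(10)] by (rule continuous_on_subset) auto
    then show ?thesis
      using IVT'[of \<phi> 0 p "X \<omega>"] that(1) w nonneg[OF w(1)] by (auto simp: Y_def)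
  qed
  \<comment> \<open>By \<open>levels\<close>, the two sides are the mean residual demand of \<open>Y\<close> at \<open>\<phi> b\<close> and at \<open>\<phi> a\<close>.\<close>
  have key: "expectation (\<lambda>\<omega>. max 0 (Y \<omega> - \<phi> b)) / prob {\<omega> \<in> space M. b < X \<omega>}
      \<le> expectation (\<lambda>\<omega>. max 0 (Y \<omega> - \<phi> a)) / prob {\<omega> \<in> space M. a < X \<omega>}"
    if ab: "0 \<le> a" "a \<le> b" and pos: "0 < prob {\<omega> \<in> space M. b < X \<omega>}" for a b
  proof -
    obtain c where c: "0 \<le> c" "\<And>x. 0 \<le> x \<Longrightarrow> \<phi> x \<le> \<phi> b + c * (x - b)"
      "\<And>x y. 0 \<le> x \<Longrightarrow> x \<le> y \<Longrightarrow> y \<le> b \<Longrightarrow> c * (y - x) \<le> \<phi> y - \<phi> x"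
      using concave_support[OF assms(9,8,10) order_trans[OF ab]] by blast
    have P: "prob {\<omega> \<in> space M. b < X \<omega>} \<le> prob {\<omega> \<in> space M. a < X \<omega>}"
      using ab by (intro finite_measure_mono) auto
    have up: "ereal a < upper_end M X" "ereal b < upper_end M X"
      using P pos contX by (auto intro!: less_upper_end)
    then have "mrd M X b \<le> mrd M X a"
      using antiX ab by (auto simp: monotone_on_def)
    then have B: "expectation (\<lambda>\<omega>. max 0 (X \<omega> - b)) / prob {\<omega> \<in> space M. b < X \<omega>}
        \<le> expectation (\<lambda>\<omega>. max 0 (X \<omega> - a)) / prob {\<omega> \<in> space M. a < X \<omega>}"
      using up nonneg assms(5) by (simp add: mrd_eq_ratio)
    show ?thesis
      using excess_comparison[OF assms(5) _ nonneg assms(8) ab c] intY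
      by (intro ratio_transfer[OF pos P _ _ \<open>0 \<le> c\<close> B]) (auto simp: Y_def)
  qed
  have "mrd M Y q \<le> mrd M Y p"
    if pq: "p \<le> q" and q: "ereal q < upper_end M Y" for p q
  proof -
    have p: "ereal p < upper_end M Y" using pq q by (meson ereal_less_eq(3) le_less_trans)
    have ratio: "mrd M Y r = expectation (\<lambda>\<omega>. max 0 (Y \<omega> - r)) / prob {\<omega> \<in> space M. r < Y \<omega>}"
      if "ereal r < upper_end M Y" for r
      using intY Y_nonneg that by (intro mrd_eq_ratio) auto
    have above0: "\<phi> 0 \<le> Y \<omega>" if "\<omega> \<in> space M" for \<omega>
      using le nonneg that by (simp add: Y_def)
    have iY: "integrable M (\<lambda>\<omega>. max 0 (Y \<omega> - r))" for r
      using intY by (intro integrable_max) auto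
    have low: "mrd M Y r = expectation Y - r" if "r < \<phi> 0" "ereal r < upper_end M Y" for r
    proof -
      have "{\<omega> \<in> space M. r < Y \<omega>} = space M" using above0 that(1) by force
      moreover have "expectation (\<lambda>\<omega>. max 0 (Y \<omega> - r)) = expectation (\<lambda>\<omega>. Y \<omega> - r)"
        using above0 that(1) by (intro Bochner_Integration.integral_cong) (force simp: max_def)+
      ultimately show ?thesis using that intY by (simp add: ratio prob_space)
    qed
    show ?thesis
    proof (cases "q < \<phi> 0")
      case True
      then show ?thesis using pq p q by (simp add: low)
    next
      case False
      then obtain b where b: "0 \<le> b" "q = \<phi> b" using surj[of q] q by (metis not_less)
      have pos: "0 < prob {\<omega> \<in> space M. b < X \<omega>}"
        using prob_exceed_pos[OF Y Y_nonneg q] b levels by simp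
      show ?thesis
      proof (cases "p < \<phi> 0")
        case True
        \<comment> \<open>\<open>X\<close> has no atom at 0, so \<open>Y\<close> exceeds \<open>\<phi> 0\<close> almost surely.\<close>
        have "prob {\<omega> \<in> space M. 0 < X \<omega>} = 1"
        proof -
          have "{\<omega> \<in> space M. 0 < X \<omega>} = space M - {\<omega> \<in> space M. X \<omega> = 0}"
            using nonneg by force
          then show ?thesis using no_atom[of 0] by (simp add: prob_compl)
        qed
        then have "mrd M Y q \<le> expectation (\<lambda>\<omega>. max 0 (Y \<omega> - \<phi> 0))"
          using key[OF order_refl b(1) pos] q b levels by (simp add: ratio)
        also have "\<dots> = expectation (\<lambda>\<omega>. Y \<omega> - \<phi> 0)"
          using above0 by (intro Bochner_Integration.integral_cong) auto
        also have "\<dots> \<le> mrd M Y p"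
          using True p intY by (simp add: low prob_space)
        finally show ?thesis .
      next
        case False
        then obtain a where a: "0 \<le> a" "p = \<phi> a" using surj[of p] p by (metis not_less)
        then have "a \<le> b" using pq b le by simp
        then show ?thesis using key[OF a(1) _ pos] p q a b levels by (simp add: ratio)
      qed
    qed
  qed
  then have "DMRD M Y"
    using intY contY Y_nonneg by (auto simp: DMRD_def monotone_on_def)
  then show ?thesis by (simp add: Y_def comp_def)
qed

end
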